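(* Let $U$ be a non-empty finite set and let $R\subseteq U\times U$ be a binary relation on $U$ that is reflexive or a preorder (reflexive and transitive). Then for all $X\subseteq U$: (1) $\underline{apr}_{p\vee s}(X)\subseteq\underline{apr}_{p}(X)\subseteq\underline{apr}_{p\wedge s}(X)\subseteq X\subseteq\overline{apr}_{p\wedge s}(X)\subseteq\overline{apr}_{p}(X)\subseteq\overline{apr}_{p\vee s}(X)$; (2) $\underline{apr}_{p\vee s}(X)\subseteq\underline{apr}_{s}(X)\subseteq\underline{apr}_{p\wedge s}(X)\subseteq X\subseteq\overline{apr}_{p\wedge s}(X)\subseteq\overline{apr}_{s}(X)\subseteq\overline{apr}_{p\vee s}(X)$.
   Context: For $x\in U$ put $R_s(x)=\{y\in U\mid (x,y)\in R\}$, $R_p(x)=\{y\in U\mid (y,x)\in R\}$, $R_{p\wedge s}(x)=R_s(x)\cap R_p(x)$, $R_{p\vee s}(x)=R_s(x)\cup R_p(x)$. For $i\in\{s,p,p\wedge s,p\vee s\}$ and $X\subseteq U$, $\underline{apr}_i(X)=\{x\in U\mid R_i(x)\subseteq X\}$ and $\overline{apr}_i(X)=\{x\in U\mid R_i(x)\cap X\neq\emptyset\}$. *)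

theory Defs
  imports Main
begin

(* The indices s, p, p \<and> s and p \<or> s, in this order. *)
datatype nbhd_index = Succ | Pred | PredAndSucc | PredOrSucc

definition succ_nbhd :: "'a set \<Rightarrow> 'a rel \<Rightarrow> 'a \<Rightarrow> 'a set" where
  "succ_nbhd U R x = {y \<in> U. (x, y) \<in> R}"

definition pred_nbhd :: "'a set \<Rightarrow> 'a rel \<Rightarrow> 'a \<Rightarrow> 'a set" where
  "pred_nbhd U R x = {y \<in> U. (y, x) \<in> R}"

fun nbhd :: "'a set \<Rightarrow> 'a rel \<Rightarrow> nbhd_index \<Rightarrow> 'a \<Rightarrow> 'a set" where
  "nbhd U R Succ x = succ_nbhd U R x"
| "nbhd U R Pred x = pred_nbhd U R x"
| "nbhd U R PredAndSucc x = succ_nbhd U R x \<inter> pred_nbhd U R x"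
| "nbhd U R PredOrSucc x = succ_nbhd U R x \<union> pred_nbhd U R x"

definition lower_apr :: "'a set \<Rightarrow> 'a rel \<Rightarrow> nbhd_index \<Rightarrow> 'a set \<Rightarrow> 'a set" where
  "lower_apr U R i X = {x \<in> U. nbhd U R i x \<subseteq> X}"

definition upper_apr :: "'a set \<Rightarrow> 'a rel \<Rightarrow> nbhd_index \<Rightarrow> 'a set \<Rightarrow> 'a set" where
  "upper_apr U R i X = {x \<in> U. nbhd U R i x \<inter> X \<noteq> {}}"

end

theory Submission
  imports Defs
begin

text \<open>Pointwise, the neighbourhood for p \<and> s lies inside those for p and s, and both lie
  inside the one for p \<or> s. Enlarging neighbourhoods shrinks lower and enlarges upper
  approximations (\<open>lower_apr_antimono\<close>, \<open>upper_apr_mono\<close>), which gives the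
  outer links of both chains. The links through \<open>X\<close> come from reflexivity: every point
  lies in its own neighbourhood.\<close>

lemma lower_apr_antimono:
  assumes "\<And>x. nbhd U R i x \<subseteq> nbhd U R j x"
  shows "lower_apr U R j X \<subseteq> lower_apr U R i X"
  using assms unfolding lower_apr_def by blast

lemma upper_apr_mono:
  assumes "\<And>x. nbhd U R i x \<subseteq> nbhd U R j x"
  shows "upper_apr U R i X \<subseteq> upper_apr U R j X"
  using assms unfolding upper_apr_def by blast

lemma lower_apr_subset:
  assumes "\<And>x. x \<in> U \<Longrightarrow> x \<in> nbhd U R i x"
  shows "lower_apr U R i X \<subseteq> X"
  using assms unfolding lower_apr_def by blast

text \<open>A point of \<open>X\<close> witnesses its own intersection;
  \<open>X \<subseteq> U\<close> places it in the carrier from which \<open>upper_apr\<close>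
  selects.\<close>

lemma subset_upper_apr:
  assumes "\<And>x. x \<in> U \<Longrightarrow> x \<in> nbhd U R i x" and "X \<subseteq> U"
  shows "X \<subseteq> upper_apr U R i X"
  using assms unfolding upper_apr_def by blast

theorem corollary29:
  fixes U :: "'a set" and R :: "'a rel"
  assumes "finite U" and "U \<noteq> {}"
    and "R \<subseteq> U \<times> U"
    and "refl_on U R \<or> preorder_on U R"
  shows "\<forall>X. X \<subseteq> U \<longrightarrow>
    (lower_apr U R PredOrSucc X \<subseteq> lower_apr U R Pred X \<and>
     lower_apr U R Pred X \<subseteq> lower_apr U R PredAndSucc X \<and>
     lower_apr U R PredAndSucc X \<subseteq> X \<and>
     X \<subseteq> upper_apr U R PredAndSucc X \<and>
     upper_apr U R PredAndSucc X \<subseteq> upper_apr U R Pred X \<and>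
     upper_apr U R Pred X \<subseteq> upper_apr U R PredOrSucc X) \<and>
    (lower_apr U R PredOrSucc X \<subseteq> lower_apr U R Succ X \<and>
     lower_apr U R Succ X \<subseteq> lower_apr U R PredAndSucc X \<and>
     lower_apr U R PredAndSucc X \<subseteq> X \<and>
     X \<subseteq> upper_apr U R PredAndSucc X \<and>
     upper_apr U R PredAndSucc X \<subseteq> upper_apr U R Succ X \<and>
     upper_apr U R Succ X \<subseteq> upper_apr U R PredOrSucc X)"
proof -
  have "refl_on U R"
    using assms(4) by (auto simp: preorder_on_def)
  \<comment> \<open>The pair (x, x) serves as both successor and predecessor pair. Only this index
    is needed, as it alone adjoins \<open>X\<close> in the chains.\<close>
  then have self: "x \<in> nbhd U R PredAndSucc x" if "x \<in> U" for x
    using that by (auto simp: succ_nbhd_def pred_nbhd_def dest: refl_onD)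
  \<comment> \<open>The goals left to \<open>auto\<close> are inclusions of an intersection in a
    component or of a component in a union, and side conditions present as assumptions.\<close>
  show ?thesis
    by (intro allI impI conjI lower_apr_antimono upper_apr_mono
        lower_apr_subset subset_upper_apr self) auto
qed

end
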